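(* Assume $K=2$. Let $\mathbf Q^\star$ be a $2\times2$ transition matrix of full rank which is irreducible and aperiodic, with stationary initial distribution $\pi^\star$, and let $f_1^\star,f_2^\star\in\mathbf L^2(\mathcal Y)$ be linearly independent probability densities, $\mathbf f^\star=(f_1^\star,f_2^\star)$. Then $H(\mathbf Q^\star,G(\mathbf f^\star))>0$.
   Context: $\mathcal Y\subset\mathbb R^D$, and $\mathbf L^2(\mathcal Y)$ is taken with respect to Lebesgue measure, with inner product $\langle\cdot,\cdot\rangle$. For $\mathbf f\in\mathbf L^2(\mathcal Y)^K$, $G=G(\mathbf f)$ is the $K\times K$ Gram matrix $G_{i,j}=\langle f_i,f_j\rangle$. For $\mathbf Q$ of full rank, irreducible and aperiodic with stationary distribution $\pi$, let $A=\mathrm{Diag}(\pi)$. For $K\times K$ matrices $U$ with $U\mathbf 1_K=0$, define $$\begin{aligned}\mathcal D=\sum_{i,j=1}^K\Big\{&(\mathbf Q^\top AUGU^\top A\mathbf Q)_{i,j}G_{i,j}(\mathbf QG\mathbf Q^\top)_{i,j}+(\mathbf Q^\top AGA\mathbf Q)_{i,j}(UGU^\top)_{i,j}(\mathbf QG\mathbf Q^\top)_{i,j}\\&+(\mathbf Q^\top AGA\mathbf Q)_{i,j}G_{i,j}(\mathbf QUGU^\top\mathbf Q^\top)_{i,j}\Big\}\\+2\sum_{i,j=1}^K\Big\{&(\mathbf Q^\top AUGA\mathbf Q)_{i,j}(UG)_{j,i}(\mathbf QG\mathbf Q^\top)_{i,j}+(\mathbf Q^\top AUGA\mathbf Q)_{i,j}(\mathbf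 QUG\mathbf Q^\top)_{j,i}G_{i,j}\\&+(UG)_{i,j}(\mathbf QUG\mathbf Q^\top)_{j,i}(\mathbf Q^\top AGA\mathbf Q)_{i,j}\Big\}.\end{aligned}$$ This is a positive semidefinite quadratic form in the free coordinates $U_{i,j}$, $1\le i\le K$, $1\le j\le K-1$. Its determinant (the determinant of its symmetric matrix) is a rational function of the entries of $\mathbf Q$ and $G$, and $H(\mathbf Q,G(\mathbf f))$ is the numerator of this determinant, written with a denominator that is positive for irreducible $\mathbf Q$. For $K=2$, with $p=\mathbf Q(1,2)$ and $q=\mathbf Q(2,1)$, one has $\pi=(q,p)/(p+q)$, $U=\begin{pmatrix}\alpha&-\alpha\\\beta&-\beta\end{pmatrix}$, and the denominator is a power of $p+q$. So, writing $\mathcal D=D_{1,1}\alpha^2+2D_{1,2}\alpha\beta+D_{2,2}\beta^2$, the claim $H>0$ is equivalent to $D_{1,1}D_{2,2}-D_{1,2}^2>0$. *)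

theory Defs
  imports "HOL-Analysis.Analysis"
begin

text \<open>\<open>Q $ i $ j\<close> is the probability of a transition from \<open>i\<close> to \<open>j\<close>.\<close>

definition transition_matrix :: "real^'k^'k \<Rightarrow> bool" where
  "transition_matrix Q \<longleftrightarrow> (\<forall>i j. 0 \<le> Q $ i $ j) \<and> (\<forall>i. (\<Sum>j\<in>UNIV. Q $ i $ j) = 1)"

primrec matpow :: "real^'k^'k \<Rightarrow> nat \<Rightarrow> real^'k^'k" where
  "matpow Q 0 = mat 1"
| "matpow Q (Suc n) = Q ** matpow Q n"

definition irreducible_chain :: "real^'k^'k \<Rightarrow> bool" where
  "irreducible_chain Q \<longleftrightarrow> (\<forall>i j. \<exists>n>0. 0 < matpow Q n $ i $ j)"

definition aperiodic_chain :: "real^'k^'k \<Rightarrow> bool" where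
  "aperiodic_chain Q \<longleftrightarrow> (\<forall>i. Gcd {n. 0 < n \<and> 0 < matpow Q n $ i $ i} = 1)"

definition stationary_distribution :: "real^'k^'k \<Rightarrow> real^'k \<Rightarrow> bool" where
  "stationary_distribution Q \<pi> \<longleftrightarrow>
     (\<forall>i. 0 \<le> \<pi> $ i) \<and> (\<Sum>i\<in>UNIV. \<pi> $ i) = 1 \<and> \<pi> v* Q = \<pi>"

definition stat_dist :: "real^'k^'k \<Rightarrow> real^'k" where
  "stat_dist Q = (THE \<pi>. stationary_distribution Q \<pi>)"

text \<open>Elements of \<open>L\<^sup>2(Y)\<close> are represented by functions; two of them are identified when they
  agree almost everywhere on \<open>Y\<close>, which is why linear independence below is an
  almost-everywhere notion.\<close>

definition L2_on :: "(real^'d) set \<Rightarrow> (real^'d \<Rightarrow> real) set" where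
  "L2_on Y = {f. f \<in> borel_measurable (lebesgue_on Y) \<and>
                 integrable (lebesgue_on Y) (\<lambda>y. (f y)\<^sup>2)}"

definition L2_inner :: "(real^'d) set \<Rightarrow> (real^'d \<Rightarrow> real) \<Rightarrow> (real^'d \<Rightarrow> real) \<Rightarrow> real" where
  "L2_inner Y f g = (\<integral>y. f y * g y \<partial>lebesgue_on Y)"

definition L2_independent :: "(real^'d) set \<Rightarrow> ('k::finite \<Rightarrow> real^'d \<Rightarrow> real) \<Rightarrow> bool" where
  "L2_independent Y f \<longleftrightarrow>
     (\<forall>c. (AE y in lebesgue_on Y. (\<Sum>i\<in>UNIV. c i * f i y) = 0) \<longrightarrow> (\<forall>i. c i = 0))"

definition probability_density_on :: "(real^'d) set \<Rightarrow> (real^'d \<Rightarrow> real) \<Rightarrow> bool" where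
  "probability_density_on Y f \<longleftrightarrow>
     (AE y in lebesgue_on Y. 0 \<le> f y) \<and> has_bochner_integral (lebesgue_on Y) f 1"

definition gram :: "(real^'d) set \<Rightarrow> ('k::finite \<Rightarrow> real^'d \<Rightarrow> real) \<Rightarrow> real^'k^'k" where
  "gram Y f = (\<chi> i j. L2_inner Y (f i) (f j))"

definition diag_matrix :: "real^'k \<Rightarrow> real^'k^'k" where
  "diag_matrix \<pi> = (\<chi> i j. if i = j then \<pi> $ i else 0)"

definition D_form :: "real^'k \<Rightarrow> real^'k^'k \<Rightarrow> real^'k^'k \<Rightarrow> real^'k^'k \<Rightarrow> real" where
  "D_form \<pi> Q G U = (let A = diag_matrix \<pi>; Qt = transpose Q; Ut = transpose U in
     (\<Sum>i\<in>UNIV. \<Sum>j\<in>UNIV.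
         (Qt ** A ** U ** G ** Ut ** A ** Q) $ i $ j * G $ i $ j * (Q ** G ** Qt) $ i $ j
       + (Qt ** A ** G ** A ** Q) $ i $ j * (U ** G ** Ut) $ i $ j * (Q ** G ** Qt) $ i $ j
       + (Qt ** A ** G ** A ** Q) $ i $ j * G $ i $ j * (Q ** U ** G ** Ut ** Qt) $ i $ j)
   + 2 * (\<Sum>i\<in>UNIV. \<Sum>j\<in>UNIV.
         (Qt ** A ** U ** G ** A ** Q) $ i $ j * (U ** G) $ j $ i * (Q ** G ** Qt) $ i $ j
       + (Qt ** A ** U ** G ** A ** Q) $ i $ j * (Q ** U ** G ** Qt) $ j $ i * G $ i $ j
       + (U ** G) $ i $ j * (Q ** U ** G ** Qt) $ j $ i * (Qt ** A ** G ** A ** Q) $ i $ j))"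

text \<open>By polarization; it represents the form by lemma \<open>D_form_eq_D_matrix\<close> below.\<close>

definition quad_form_matrix :: "(real^'n \<Rightarrow> real) \<Rightarrow> real^'n^'n" where
  "quad_form_matrix F =
     (\<chi> a b. (F (axis a 1 + axis b 1) - F (axis a 1) - F (axis b 1)) / 2)"

text \<open>For two states, a matrix with vanishing row sums is determined by its first column, the
  free coordinates \<open>c = (\<alpha>, \<beta>)\<close>.\<close>

definition U_of :: "real^2 \<Rightarrow> real^2^2" where
  "U_of c = (\<chi> i j. if j = 1 then c $ i else - c $ i)"

definition D_matrix :: "real^2 \<Rightarrow> real^2^2 \<Rightarrow> real^2^2 \<Rightarrow> real^2^2" where
  "D_matrix \<pi> Q G = quad_form_matrix (\<lambda>c. D_form \<pi> Q G (U_of c))"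

text \<open>With \<open>p = Q $ 1 $ 2\<close> and \<open>q = Q $ 2 $ 1\<close>, the stationary distribution is
  \<open>(q, p) / (p + q)\<close>. The form is homogeneous of degree 2 in it, so the \<open>2 \<times> 2\<close> determinant has
  denominator \<open>(p + q)\<^sup>4\<close>; \<open>H\<close> is the numerator. Lemma \<open>H_eq_numerator\<close> below exhibits it as a
  polynomial in the entries of \<open>Q\<close> and \<open>G\<close>.\<close>

definition H :: "real^2^2 \<Rightarrow> real^2^2 \<Rightarrow> real" where
  "H Q G = (Q $ 1 $ 2 + Q $ 2 $ 1) ^ 4 * det (D_matrix (stat_dist Q) Q G)"

definition D_bilin :: "real^'k \<Rightarrow> real^'k^'k \<Rightarrow> real^'k^'k \<Rightarrow> real^'k^'k \<Rightarrow> real^'k^'k \<Rightarrow> real" where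
  "D_bilin \<pi> Q G U V = (let A = diag_matrix \<pi>; Qt = transpose Q; Vt = transpose V in
     (\<Sum>i\<in>UNIV. \<Sum>j\<in>UNIV.
         (Qt ** A ** U ** G ** Vt ** A ** Q) $ i $ j * G $ i $ j * (Q ** G ** Qt) $ i $ j
       + (Qt ** A ** G ** A ** Q) $ i $ j * (U ** G ** Vt) $ i $ j * (Q ** G ** Qt) $ i $ j
       + (Qt ** A ** G ** A ** Q) $ i $ j * G $ i $ j * (Q ** U ** G ** Vt ** Qt) $ i $ j)
   + 2 * (\<Sum>i\<in>UNIV. \<Sum>j\<in>UNIV.
         (Qt ** A ** U ** G ** A ** Q) $ i $ j * (V ** G) $ j $ i * (Q ** G ** Qt) $ i $ j
       + (Qt ** A ** U ** G ** A ** Q) $ i $ j * (Q ** V ** G ** Qt) $ j $ i * G $ i $ j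
       + (U ** G) $ i $ j * (Q ** V ** G ** Qt) $ j $ i * (Qt ** A ** G ** A ** Q) $ i $ j))"

lemma D_form_eq_bilin: "D_form \<pi> Q G U = D_bilin \<pi> Q G U U"
  by (simp add: D_form_def D_bilin_def)

lemma transpose_add: "transpose (A + B) = transpose A + transpose (B :: real^'n^'m)"
  by (simp add: transpose_def vec_eq_iff)

lemma transpose_scaleR: "transpose (r *\<^sub>R A) = r *\<^sub>R transpose (A :: real^'n^'m)"
  by (simp add: transpose_def vec_eq_iff)

lemma matrix_scaleR_right: "A ** (r *\<^sub>R B) = r *\<^sub>R (A ** B)" for A :: "real^'n^'m"
  by (simp add: matrix_scalar_ac scalar_matrix_assoc)

lemma matrix_add_rdist: "(A + B) ** C = A ** C + B ** C" for A :: "real^'n^'m"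
  by (simp add: matrix_matrix_mult_def vec_eq_iff sum.distrib distrib_right)

lemmas mat_lin = matrix_add_ldistrib matrix_add_rdist transpose_add transpose_scaleR
  matrix_scaleR_right scalar_matrix_assoc[symmetric]

lemma D_bilin_add:
  "D_bilin \<pi> Q G (U + U') V = D_bilin \<pi> Q G U V + D_bilin \<pi> Q G U' V"
  "D_bilin \<pi> Q G U (V + V') = D_bilin \<pi> Q G U V + D_bilin \<pi> Q G U V'"
  by (simp_all add: D_bilin_def Let_def mat_lin distrib_left distrib_right sum.distrib)

lemma D_bilin_scaleR:
  "D_bilin \<pi> Q G (r *\<^sub>R U) V = r * D_bilin \<pi> Q G U V"
  "D_bilin \<pi> Q G U (r *\<^sub>R V) = r * D_bilin \<pi> Q G U V"
  by (simp_all add: D_bilin_def Let_def mat_lin distrib_left sum_distrib_left mult.assoc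
      mult.left_commute)

lemma U_of_add: "U_of (c + d) = U_of c + U_of d"
  by (simp add: U_of_def vec_eq_iff)

lemma U_of_scaleR: "U_of (r *\<^sub>R c) = r *\<^sub>R U_of c"
  by (simp add: U_of_def vec_eq_iff)

lemma range_U_of: "range U_of = {U. U *v 1 = 0}"
proof -
  have "U = U_of (\<chi> i. U $ i $ 1)" if "U *v 1 = 0" for U :: "real^2^2"
    using that
    by (auto simp: U_of_def vec_eq_iff matrix_vector_mult_def forall_2 sum_2)
  moreover have "U_of c *v 1 = 0" for c
    by (simp add: U_of_def vec_eq_iff matrix_vector_mult_def sum_2)
  ultimately show ?thesis
    by blast
qed

lemma D_matrix_symmetric: "transpose (D_matrix \<pi> Q G) = D_matrix \<pi> Q G"
  by (simp add: D_matrix_def quad_form_matrix_def transpose_def vec_eq_iff add.commute)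

lemma D_form_eq_D_matrix: "D_form \<pi> Q G (U_of c) = c \<bullet> (D_matrix \<pi> Q G *v c)"
proof -
  have "c = c $ 1 *\<^sub>R axis 1 1 + c $ 2 *\<^sub>R axis 2 1"
    by (simp add: vec_eq_iff forall_2 axis_def)
  then have U: "U_of c = c $ 1 *\<^sub>R U_of (axis 1 1) + c $ 2 *\<^sub>R U_of (axis 2 1)"
    by (metis U_of_add U_of_scaleR)
  show ?thesis
    unfolding U
    by (simp add: D_form_eq_bilin D_bilin_add D_bilin_scaleR D_matrix_def quad_form_matrix_def
        U_of_add inner_vec_def matrix_vector_mult_def sum_2 field_simps)
qed

lemma D_form_scaleR: "D_form (s *\<^sub>R \<pi>) Q G U = s\<^sup>2 * D_form \<pi> Q G U"
proof -
  have "diag_matrix (s *\<^sub>R \<pi>) = s *\<^sub>R diag_matrix \<pi>"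
    by (simp add: diag_matrix_def vec_eq_iff)
  then show ?thesis
    by (simp add: D_form_def Let_def mat_lin distrib_left sum_distrib_left mult.assoc
        mult.left_commute power2_eq_square)
qed

lemma stationary_distribution_2:
  fixes Q :: "real^2^2"
  assumes "transition_matrix Q" and pq: "0 < Q $ 1 $ 2 + Q $ 2 $ 1"
  shows "stationary_distribution Q \<pi> \<longleftrightarrow>
    \<pi> = (1 / (Q $ 1 $ 2 + Q $ 2 $ 1)) *\<^sub>R vector [Q $ 2 $ 1, Q $ 1 $ 2]"
proof -
  define p q where "p = Q $ 1 $ 2" and "q = Q $ 2 $ 1"
  have Q: "Q $ 1 $ 1 = 1 - p" "Q $ 2 $ 2 = 1 - q" "0 \<le> p" "0 \<le> q"
    using assms(1) by (auto simp: transition_matrix_def p_def q_def forall_2 sum_2)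
  have "stationary_distribution Q \<pi> \<longleftrightarrow>
      0 \<le> \<pi> $ 1 \<and> 0 \<le> \<pi> $ 2 \<and> \<pi> $ 1 + \<pi> $ 2 = 1 \<and> q * \<pi> $ 2 = p * \<pi> $ 1"
    by (auto simp: stationary_distribution_def vector_matrix_mult_def vec_eq_iff forall_2 sum_2 Q
        p_def[symmetric] q_def[symmetric] algebra_simps)
  also have "\<dots> \<longleftrightarrow> \<pi> $ 1 = q / (p + q) \<and> \<pi> $ 2 = p / (p + q)"
  proof
    assume *: "0 \<le> \<pi> $ 1 \<and> 0 \<le> \<pi> $ 2 \<and> \<pi> $ 1 + \<pi> $ 2 = 1 \<and> q * \<pi> $ 2 = p * \<pi> $ 1"
    then have e: "\<pi> $ 2 = 1 - \<pi> $ 1"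
      by linarith
    with * have "\<pi> $ 1 * (p + q) = q"
      by (simp add: algebra_simps)
    moreover from this have "\<pi> $ 2 * (p + q) = p"
      unfolding e by (simp add: algebra_simps)
    ultimately show "\<pi> $ 1 = q / (p + q) \<and> \<pi> $ 2 = p / (p + q)"
      using pq by (simp add: p_def q_def eq_divide_eq)
  next
    assume *: "\<pi> $ 1 = q / (p + q) \<and> \<pi> $ 2 = p / (p + q)"
    have "q / (p + q) + p / (p + q) = 1"
      using pq by (simp add: p_def q_def add_divide_distrib[symmetric] add.commute)
    with * show "0 \<le> \<pi> $ 1 \<and> 0 \<le> \<pi> $ 2 \<and> \<pi> $ 1 + \<pi> $ 2 = 1 \<and> q * \<pi> $ 2 = p * \<pi> $ 1"
      using Q by simp
  qed
  finally show ?thesis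
    by (simp add: vec_eq_iff forall_2 p_def q_def)
qed

lemma stat_dist_2:
  fixes Q :: "real^2^2"
  assumes "transition_matrix Q" "0 < Q $ 1 $ 2 + Q $ 2 $ 1"
  shows "stat_dist Q = (1 / (Q $ 1 $ 2 + Q $ 2 $ 1)) *\<^sub>R vector [Q $ 2 $ 1, Q $ 1 $ 2]"
  unfolding stat_dist_def stationary_distribution_2[OF assms] by simp

lemma H_eq_numerator:
  fixes Q :: "real^2^2"
  assumes "transition_matrix Q" "0 < Q $ 1 $ 2 + Q $ 2 $ 1"
  shows "H Q G = det (D_matrix (vector [Q $ 2 $ 1, Q $ 1 $ 2]) Q G)"
proof -
  define s where "s = Q $ 1 $ 2 + Q $ 2 $ 1"
  define \<nu> :: "real^2" where "\<nu> = vector [Q $ 2 $ 1, Q $ 1 $ 2]"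
  have s: "s > 0" using assms by (simp add: s_def)
  have "D_matrix ((1 / s) *\<^sub>R \<nu>) Q G $ a $ b = D_matrix \<nu> Q G $ a $ b / s\<^sup>2" for a b
    by (simp add: D_matrix_def quad_form_matrix_def D_form_scaleR diff_divide_distrib power_divide)
  then have "s ^ 4 * det (D_matrix ((1 / s) *\<^sub>R \<nu>) Q G) = det (D_matrix \<nu> Q G)"
    using s by (simp add: det_2 right_diff_distrib power2_eq_square power4_eq_xxxx)
  then show ?thesis
    by (simp add: H_def stat_dist_2[OF assms] s_def \<nu>_def)
qed

end

theory Submission
  imports Defs
begin

text \<open>The form \<open>D_form \<pi> Q G U\<close> is the squared norm of a derivative. Three consecutive observations
  of the stationary chain have density
  \<open>\<Sum>\<^sub>j (Q\<^sup>T A f)\<^sub>j \<otimes> f\<^sub>j \<otimes> (Q f)\<^sub>j\<close>, where \<open>A = Diag \<pi>\<close>, and differentiating it in the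
  direction \<open>f \<mapsto> f + U f\<close> gives
  \<open>T = \<Sum>\<^sub>j (Q\<^sup>T A U f)\<^sub>j \<otimes> f\<^sub>j \<otimes> (Q f)\<^sub>j + (Q\<^sup>T A f)\<^sub>j \<otimes> (U f)\<^sub>j \<otimes> (Q f)\<^sub>j
  + (Q\<^sup>T A f)\<^sub>j \<otimes> f\<^sub>j \<otimes> (Q U f)\<^sub>j\<close>. The nine inner products of the summands of \<open>T\<close> make up
  \<open>D_form\<close>. In coordinates, a factorization \<open>G = L L\<^sup>T\<close> replaces \<open>f\<close> by the rows of \<open>L\<close>
  (\<open>D_form_eq_sum_squares\<close>).

  So it has to be shown that \<open>T = 0\<close> forces \<open>U = 0\<close> when \<open>U\<close> has vanishing row sums. This is the
  infinitesimal uniqueness of the decomposition of a tensor whose three families of factors are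
  linearly independent: each of the families \<open>Q\<^sup>T A f\<close>, \<open>f\<close>, \<open>Q f\<close> has a dual family, and
  contracting \<open>T\<close> with the dual vectors of indices \<open>s\<close>, \<open>t\<close>, \<open>s\<close>, where \<open>s \<noteq> t\<close>, kills the
  first and third sums and leaves \<open>U\<^sub>s\<^sub>t\<close>. Hence \<open>U\<close> is diagonal, and the row sums make it zero
  (\<open>D_form_pos\<close>). The argument holds for any number of states.

  For two states, irreducibility means that both off-diagonal entries of \<open>Q\<close> are positive, so that
  \<open>A\<close> is invertible; linear independence of the densities makes \<open>G\<close> positive definite, so that it
  has a Cholesky factor; and \<open>H\<close> is the determinant of a positive definite \<open>2 \<times> 2\<close> matrix.\<close>

section \<open>The form as the squared norm of a tensor\<close>

text \<open>The coordinates of \<open>\<Sum>\<^sub>j X\<^sub>j \<otimes> Y\<^sub>j \<otimes> Z\<^sub>j\<close>, where \<open>X\<^sub>j\<close>, \<open>Y\<^sub>j\<close>, \<open>Z\<^sub>j\<close> are rows.\<close>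

definition row_tensor :: "real^'a^'k \<Rightarrow> real^'b^'k \<Rightarrow> real^'c^'k \<Rightarrow> 'a \<Rightarrow> 'b \<Rightarrow> 'c \<Rightarrow> real" where
  "row_tensor X Y Z a b c = (\<Sum>j\<in>UNIV. X $ j $ a * Y $ j $ b * Z $ j $ c)"

lemma sum_swap_1_3:
  "(\<Sum>j\<in>J. \<Sum>a\<in>A. \<Sum>b\<in>B. \<Sum>c\<in>C. h j a b c) =
   (\<Sum>a\<in>A. \<Sum>b\<in>B. \<Sum>c\<in>C. \<Sum>j\<in>J. (h j a b c :: real))"
  by (subst sum.swap, intro sum.cong refl, subst sum.swap, intro sum.cong refl, rule sum.swap)

lemma sum_swap_2_3:
  "(\<Sum>i\<in>I. \<Sum>j\<in>J. \<Sum>a\<in>A. \<Sum>b\<in>B. \<Sum>c\<in>C. h i j a b c) =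
   (\<Sum>a\<in>A. \<Sum>b\<in>B. \<Sum>c\<in>C. \<Sum>i\<in>I. \<Sum>j\<in>J. (h i j a b c :: real))"
  by (simp only: sum_swap_1_3[where A = A and B = B and C = C])

lemma prod_of_three_sums:
  "(\<Sum>a\<in>A. f a) * (\<Sum>b\<in>B. g b) * (\<Sum>c\<in>C. h c) =
   (\<Sum>a\<in>A. \<Sum>b\<in>B. \<Sum>c\<in>C. f a * g b * (h c :: real))"
  by (simp only: sum_distrib_left[symmetric] sum_distrib_right[symmetric])

text \<open>The inner product of elementary tensors is the product of the inner products of their
  factors.\<close>

lemma sum_hadamard_eq_inner_row_tensor:
  fixes X X' :: "real^'a^'k" and Y Y' :: "real^'b^'k" and Z Z' :: "real^'c^'k"
  shows "(\<Sum>i\<in>UNIV. \<Sum>j\<in>UNIV. (X ** transpose X') $ i $ j * (Y ** transpose Y') $ i $ j *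
            (Z ** transpose Z') $ i $ j) =
         (\<Sum>a\<in>UNIV. \<Sum>b\<in>UNIV. \<Sum>c\<in>UNIV. row_tensor X Y Z a b c * row_tensor X' Y' Z' a b c)"
proof -
  have "(\<Sum>i\<in>UNIV. \<Sum>j\<in>UNIV. (X ** transpose X') $ i $ j * (Y ** transpose Y') $ i $ j *
            (Z ** transpose Z') $ i $ j) =
    (\<Sum>i\<in>UNIV. \<Sum>j\<in>UNIV. \<Sum>a\<in>UNIV. \<Sum>b\<in>UNIV. \<Sum>c\<in>UNIV.
       (X $ i $ a * Y $ i $ b * Z $ i $ c) * (X' $ j $ a * Y' $ j $ b * Z' $ j $ c))"
    by (simp only: matrix_matrix_mult_def transpose_def vec_lambda_beta prod_of_three_sums)
      (simp add: mult_ac)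
  also have "\<dots> = (\<Sum>a\<in>UNIV. \<Sum>b\<in>UNIV. \<Sum>c\<in>UNIV. \<Sum>i\<in>UNIV. \<Sum>j\<in>UNIV.
       (X $ i $ a * Y $ i $ b * Z $ i $ c) * (X' $ j $ a * Y' $ j $ b * Z' $ j $ c))"
    by (rule sum_swap_2_3)
  also have "\<dots> = (\<Sum>a\<in>UNIV. \<Sum>b\<in>UNIV. \<Sum>c\<in>UNIV. row_tensor X Y Z a b c * row_tensor X' Y' Z' a b c)"
    by (simp add: row_tensor_def sum_product)
  finally show ?thesis .
qed

text \<open>The product rule for \<open>\<Sum>\<^sub>j (Q\<^sup>T A f)\<^sub>j \<otimes> f\<^sub>j \<otimes> (Q f)\<^sub>j\<close> in the direction \<open>U f\<close>, with the rows of
  \<open>L\<close> as coordinate vectors of \<open>f\<close>.\<close>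

definition tensor_derivative ::
  "real^'k \<Rightarrow> real^'k^'k \<Rightarrow> real^'k^'k \<Rightarrow> real^'k^'k \<Rightarrow> 'k \<Rightarrow> 'k \<Rightarrow> 'k \<Rightarrow> real" where
  "tensor_derivative \<pi> Q L U a b c = (let B = transpose Q ** diag_matrix \<pi> in
     row_tensor (B ** U ** L) L (Q ** L) a b c + row_tensor (B ** L) (U ** L) (Q ** L) a b c
     + row_tensor (B ** L) L (Q ** U ** L) a b c)"

lemma transpose_diag_matrix: "transpose (diag_matrix \<pi>) = diag_matrix \<pi>"
  by (auto simp: diag_matrix_def transpose_def vec_eq_iff)

text \<open>Expanding the square of the three-term sum gives the three squares in the first half of
  \<open>D_form\<close> and, doubled, the three mixed products in the second.\<close>

lemma D_form_eq_sum_squares: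
  fixes Q L U :: "real^'k^'k"
  shows "D_form \<pi> Q (L ** transpose L) U =
     (\<Sum>a\<in>UNIV. \<Sum>b\<in>UNIV. \<Sum>c\<in>UNIV. (tensor_derivative \<pi> Q L U a b c)\<^sup>2)"
proof -
  define B where "B = transpose Q ** diag_matrix \<pi>"
  define t\<^sub>1 where "t\<^sub>1 = row_tensor (B ** U ** L) L (Q ** L)"
  define t\<^sub>2 where "t\<^sub>2 = row_tensor (B ** L) (U ** L) (Q ** L)"
  define t\<^sub>3 where "t\<^sub>3 = row_tensor (B ** L) L (Q ** U ** L)"
  \<comment> \<open>The cross terms of \<open>D_form\<close> contain transposed entries such as \<open>(U G)\<^sub>j\<^sub>i\<close>; the Gram matrices
    below have them in the common position \<open>(i, j)\<close>.\<close>
  have tr: "(V ** L ** (transpose L ** transpose W)) $ j $ i =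
      (W ** L ** (transpose L ** transpose V)) $ i $ j" for V W :: "real^'k^'k" and i j
  proof -
    have "W ** L ** (transpose L ** transpose V) =
        transpose (V ** L ** (transpose L ** transpose W))"
      by (simp add: matrix_transpose_mul matrix_mul_assoc)
    then show ?thesis
      by (simp add: transpose_def)
  qed
  have "D_form \<pi> Q (L ** transpose L) U =
    (\<Sum>i\<in>UNIV. \<Sum>j\<in>UNIV.
      ((B ** U ** L) ** transpose (B ** U ** L)) $ i $ j * (L ** transpose L) $ i $ j
        * ((Q ** L) ** transpose (Q ** L)) $ i $ j) +
    (\<Sum>i\<in>UNIV. \<Sum>j\<in>UNIV.
      ((B ** L) ** transpose (B ** L)) $ i $ j * ((U ** L) ** transpose (U ** L)) $ i $ j
        * ((Q ** L) ** transpose (Q ** L)) $ i $ j) +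
    (\<Sum>i\<in>UNIV. \<Sum>j\<in>UNIV.
      ((B ** L) ** transpose (B ** L)) $ i $ j * (L ** transpose L) $ i $ j
        * ((Q ** U ** L) ** transpose (Q ** U ** L)) $ i $ j) +
    2 * ((\<Sum>i\<in>UNIV. \<Sum>j\<in>UNIV.
      ((B ** U ** L) ** transpose (B ** L)) $ i $ j * (L ** transpose (U ** L)) $ i $ j
        * ((Q ** L) ** transpose (Q ** L)) $ i $ j) +
    (\<Sum>i\<in>UNIV. \<Sum>j\<in>UNIV.
      ((B ** U ** L) ** transpose (B ** L)) $ i $ j * (L ** transpose L) $ i $ j
        * ((Q ** L) ** transpose (Q ** U ** L)) $ i $ j) +
    (\<Sum>i\<in>UNIV. \<Sum>j\<in>UNIV.
      ((B ** L) ** transpose (B ** L)) $ i $ j * ((U ** L) ** transpose L) $ i $ j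
        * ((Q ** L) ** transpose (Q ** U ** L)) $ i $ j))"
  proof -
    have e1: "(U ** (L ** transpose L)) $ j $ i = (L ** transpose (U ** L)) $ i $ j" for i j
      using tr[where V = U and W = "mat 1"]
      by (simp add: matrix_transpose_mul matrix_mul_assoc transpose_mat)
    have e2: "(Q ** U ** (L ** transpose L) ** transpose Q) $ j $ i =
        ((Q ** L) ** transpose (Q ** U ** L)) $ i $ j" for i j
      using tr[where V = "Q ** U" and W = Q] by (simp add: matrix_transpose_mul matrix_mul_assoc)
    show ?thesis
      unfolding D_form_def Let_def e1[symmetric] e2
      by (simp add: sum.distrib B_def matrix_transpose_mul transpose_diag_matrix matrix_mul_assoc
          mult_ac)
  qed
  also have "\<dots> = (\<Sum>a\<in>UNIV. \<Sum>b\<in>UNIV. \<Sum>c\<in>UNIV. (t\<^sub>1 a b c + t\<^sub>2 a b c + t\<^sub>3 a b c)\<^sup>2)"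
    unfolding sum_hadamard_eq_inner_row_tensor t\<^sub>1_def[symmetric] t\<^sub>2_def[symmetric] t\<^sub>3_def[symmetric]
    by (simp add: sum.distrib[symmetric] sum_distrib_left power2_eq_square algebra_simps)
  finally show ?thesis
    by (simp add: tensor_derivative_def Let_def B_def t\<^sub>1_def t\<^sub>2_def t\<^sub>3_def)
qed

section \<open>Injectivity of the derivative\<close>

lemma row_tensor_contract:
  fixes \<alpha> :: "real^'a2^'a" and \<beta> :: "real^'b2^'b" and \<gamma> :: "real^'c2^'c"
  shows "row_tensor (X ** \<alpha>) (Y ** \<beta>) (Z ** \<gamma>) r s t =
    (\<Sum>a\<in>UNIV. \<Sum>b\<in>UNIV. \<Sum>c\<in>UNIV. row_tensor X Y Z a b c * (\<alpha> $ a $ r * \<beta> $ b $ s * \<gamma> $ c $ t))"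
proof -
  have "row_tensor (X ** \<alpha>) (Y ** \<beta>) (Z ** \<gamma>) r s t =
    (\<Sum>j\<in>UNIV. \<Sum>a\<in>UNIV. \<Sum>b\<in>UNIV. \<Sum>c\<in>UNIV.
       X $ j $ a * Y $ j $ b * Z $ j $ c * (\<alpha> $ a $ r * \<beta> $ b $ s * \<gamma> $ c $ t))"
    by (simp only: row_tensor_def matrix_matrix_mult_def vec_lambda_beta prod_of_three_sums)
      (simp add: mult_ac)
  also have "\<dots> = (\<Sum>a\<in>UNIV. \<Sum>b\<in>UNIV. \<Sum>c\<in>UNIV. \<Sum>j\<in>UNIV.
       X $ j $ a * Y $ j $ b * Z $ j $ c * (\<alpha> $ a $ r * \<beta> $ b $ s * \<gamma> $ c $ t))"
    by (rule sum_swap_1_3)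
  finally show ?thesis
    by (simp add: row_tensor_def sum_distrib_right)
qed

text \<open>The rows of an invertible matrix are a basis, and the columns of its inverse are the dual
  basis. Contraction with dual vectors of indices \<open>s\<close>, \<open>t\<close>, \<open>s\<close> turns the unperturbed factors into
  unit vectors, so that each of them selects one summand. In the first and the third sum the middle
  factor selects \<open>j = t\<close> and an outer one \<open>j = s\<close>, and nothing is left; in the second sum both
  outer factors select \<open>j = s\<close>, which leaves \<open>U\<^sub>s\<^sub>t\<close>.\<close>

lemma off_diagonal_zero_if_tensor_derivative_zero:
  fixes Q L U :: "real^'k^'k"
  assumes inv: "invertible Q" "invertible (diag_matrix \<pi>)" "invertible L"
    and zero: "\<And>a b c. tensor_derivative \<pi> Q L U a b c = 0"
    and "s \<noteq> t"
  shows "U $ s $ t = 0"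
proof -
  define B where "B = transpose Q ** diag_matrix \<pi>"
  have "invertible (B ** L)" "invertible (Q ** L)"
    using inv by (simp_all add: B_def invertible_det_nz det_mul)
  then obtain \<alpha> \<beta> \<gamma> where dual: "B ** L ** \<alpha> = mat 1" "L ** \<beta> = mat 1" "Q ** L ** \<gamma> = mat 1"
    using inv(3) unfolding invertible_def by metis
  have "0 = (\<Sum>a\<in>UNIV. \<Sum>b\<in>UNIV. \<Sum>c\<in>UNIV.
      tensor_derivative \<pi> Q L U a b c * (\<alpha> $ a $ s * \<beta> $ b $ t * \<gamma> $ c $ s))"
    by (simp add: zero)
  also have "\<dots> = row_tensor (B ** U ** L ** \<alpha>) (L ** \<beta>) (Q ** L ** \<gamma>) s t s
      + row_tensor (B ** L ** \<alpha>) (U ** L ** \<beta>) (Q ** L ** \<gamma>) s t s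
      + row_tensor (B ** L ** \<alpha>) (L ** \<beta>) (Q ** U ** L ** \<gamma>) s t s"
    by (simp add: row_tensor_contract tensor_derivative_def B_def Let_def distrib_right sum.distrib)
  also have "\<dots> = U $ s $ t"
  proof -
    have U: "U ** L ** \<beta> = U"
      by (simp add: matrix_mul_assoc[symmetric] dual)
    have unit_rows: "row_tensor X (mat 1) (mat 1) s t s = 0"
      "row_tensor (mat 1) (mat 1) X s t s = 0"
      "row_tensor (mat 1) U (mat 1) s t s = U $ s $ t" for X :: "real^'k^'k"
      using \<open>s \<noteq> t\<close> by (auto simp: row_tensor_def mat_def if_distrib if_distribR cong: if_cong
          intro!: sum.neutral)
    show ?thesis
      by (simp add: dual U unit_rows)
  qed
  finally show ?thesis
    by simp
qed

lemma D_form_pos: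
  fixes Q L U :: "real^'k^'k"
  assumes inv: "invertible Q" "invertible (diag_matrix \<pi>)" "invertible L"
    and "U *v 1 = 0" "U \<noteq> 0"
  shows "0 < D_form \<pi> Q (L ** transpose L) U"
proof -
  have "\<exists>a b c. tensor_derivative \<pi> Q L U a b c \<noteq> 0"
  proof (rule ccontr)
    assume "\<not> ?thesis"
    then have off: "U $ s $ t = 0" if "s \<noteq> t" for s t
      using off_diagonal_zero_if_tensor_derivative_zero[OF inv _ that] by blast
    have "U $ s $ s = (U *v 1) $ s" for s
    proof -
      have "(U *v 1) $ s = U $ s $ s + (\<Sum>t\<in>UNIV - {s}. U $ s $ t)"
        by (simp add: matrix_vector_mult_def sum.remove[of UNIV s])
      then show ?thesis
        by (simp add: off)
    qed
    then have "U = 0"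
      using off \<open>U *v 1 = 0\<close> by (metis vec_eq_iff zero_index)
    with \<open>U \<noteq> 0\<close> show False ..
  qed
  then obtain a b c where *: "tensor_derivative \<pi> Q L U a b c \<noteq> 0"
    by blast
  have 1: "0 < (\<Sum>c\<in>UNIV. (tensor_derivative \<pi> Q L U a b c)\<^sup>2)"
    by (rule sum_pos2[of _ c]) (use * in auto)
  have 2: "0 < (\<Sum>b\<in>UNIV. \<Sum>c\<in>UNIV. (tensor_derivative \<pi> Q L U a b c)\<^sup>2)"
    by (rule sum_pos2[of _ b]) (use 1 in \<open>auto intro!: sum_nonneg\<close>)
  show ?thesis
    unfolding D_form_eq_sum_squares
    by (rule sum_pos2[of _ a]) (use 2 in \<open>auto intro!: sum_nonneg\<close>)
qed

section \<open>Positive definite matrices of order two\<close>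

lemma posdef_2:
  fixes M :: "real^2^2"
  assumes sym: "transpose M = M" and pos: "\<And>c. c \<noteq> 0 \<Longrightarrow> 0 < c \<bullet> (M *v c)"
  shows "0 < M $ 1 $ 1" and "0 < det M"
proof -
  have M21: "M $ 2 $ 1 = M $ 1 $ 2"
    using arg_cong[OF sym, of "\<lambda>N. N $ 1 $ 2"] by (simp add: transpose_def)
  have form: "c \<bullet> (M *v c) = M$1$1 * (c$1)\<^sup>2 + 2 * M$1$2 * c$1 * c$2 + M$2$2 * (c$2)\<^sup>2" for c
    by (simp add: inner_vec_def matrix_vector_mult_def sum_2 M21 power2_eq_square algebra_simps)
  have "(axis 1 1 :: real^2) \<noteq> 0"
    by (simp add: axis_eq_0_iff)
  from pos[OF this] show M11: "0 < M $ 1 $ 1"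
    by (simp add: form axis_def)
  \<comment> \<open>Among the vectors with second entry \<open>M $ 1 $ 1\<close>, this one minimizes the form.\<close>
  define c :: "real^2" where "c = vector [- M $ 1 $ 2, M $ 1 $ 1]"
  have "c \<noteq> 0"
    using M11 by (simp add: c_def vec_eq_iff forall_2)
  from pos[OF this] have "0 < M $ 1 $ 1 * det M"
    by (simp add: form c_def det_2 M21 power2_eq_square algebra_simps)
  with M11 show "0 < det M"
    by (simp add: zero_less_mult_iff)
qed

lemma cholesky_2:
  fixes M :: "real^2^2"
  assumes sym: "transpose M = M" and pos: "\<And>c. c \<noteq> 0 \<Longrightarrow> 0 < c \<bullet> (M *v c)"
  obtains L :: "real^2^2" where "invertible L" "M = L ** transpose L"
proof -
  note M11 = posdef_2(1)[OF assms] and det = posdef_2(2)[OF assms]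
  have M21: "M $ 2 $ 1 = M $ 1 $ 2"
    using arg_cong[OF sym, of "\<lambda>N. N $ 1 $ 2"] by (simp add: transpose_def)
  define d where "d = sqrt (M $ 1 $ 1)"
  define e where "e = sqrt (det M / M $ 1 $ 1)"
  have d: "0 < d" "d * d = M $ 1 $ 1" and e: "0 < e" "e * e = det M / M $ 1 $ 1"
    using M11 det by (auto simp: d_def e_def)
  define L :: "real^2^2" where "L = vector [vector [d, 0], vector [M $ 1 $ 2 / d, e]]"
  have "M $ 1 $ 2 / d * (M $ 1 $ 2 / d) + e * e = M $ 2 $ 2"
  proof -
    have sq: "M $ 1 $ 2 / d * (M $ 1 $ 2 / d) = M $ 1 $ 2 * M $ 1 $ 2 / M $ 1 $ 1"
      unfolding d(2)[symmetric] by (rule times_divide_times_eq)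
    show ?thesis
      unfolding sq e(2) using M11 by (simp add: det_2 M21 field_simps)
  qed
  then have "M = L ** transpose L"
    using d by (simp add: L_def vec_eq_iff forall_2 matrix_matrix_mult_def transpose_def sum_2 M21)
  moreover have "invertible L"
    using d(1) e(1) by (simp add: invertible_det_nz det_2 L_def)
  ultimately show thesis
    by (rule that[rotated])
qed

section \<open>The Gram matrix\<close>

lemma integrable_mult_L2_on:
  assumes "f \<in> L2_on Y" "g \<in> L2_on Y"
  shows "integrable (lebesgue_on Y) (\<lambda>y. f y * g y)"
proof (rule Bochner_Integration.integrable_bound)
  show "integrable (lebesgue_on Y) (\<lambda>y. (f y)\<^sup>2 + (g y)\<^sup>2)"
    using assms by (simp add: L2_on_def)
  show "(\<lambda>y. f y * g y) \<in> borel_measurable (lebesgue_on Y)"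
    using assms by (auto simp: L2_on_def)
  have "\<bar>a * b\<bar> \<le> a\<^sup>2 + b\<^sup>2" for a b :: real
  proof -
    have "2 * (\<bar>a\<bar> * \<bar>b\<bar>) \<le> a\<^sup>2 + b\<^sup>2"
      using sum_squares_bound[of "\<bar>a\<bar>" "\<bar>b\<bar>"] by simp
    moreover have "0 \<le> \<bar>a\<bar> * \<bar>b\<bar>"
      by simp
    ultimately show ?thesis
      unfolding abs_mult by linarith
  qed
  then show "AE y in lebesgue_on Y. norm (f y * g y) \<le> norm ((f y)\<^sup>2 + (g y)\<^sup>2)"
    by simp
qed

lemma transpose_gram: "transpose (gram Y f) = gram Y f"
  by (simp add: gram_def transpose_def L2_inner_def vec_eq_iff mult.commute)

lemma gram_posdef:
  fixes f :: "'k::finite \<Rightarrow> real^'d \<Rightarrow> real"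
  assumes L2: "\<And>i. f i \<in> L2_on Y" and ind: "L2_independent Y f" and "c \<noteq> 0"
  shows "0 < c \<bullet> (gram Y f *v c)"
proof -
  define g where "g y = (\<Sum>i\<in>UNIV. c $ i * f i y)" for y
  have g2: "(g y)\<^sup>2 = (\<Sum>i\<in>UNIV. \<Sum>j\<in>UNIV. c $ i * c $ j * (f i y * f j y))" for y
    by (simp add: g_def power2_eq_square sum_product mult_ac)
  have int: "integrable (lebesgue_on Y) (\<lambda>y. (g y)\<^sup>2)"
    unfolding g2 by (intro Bochner_Integration.integrable_sum integrable_mult_right
        integrable_mult_L2_on L2)
  have eq: "c \<bullet> (gram Y f *v c) = (\<integral>y. (g y)\<^sup>2 \<partial>lebesgue_on Y)"
    unfolding g2
    by (simp add: integrable_mult_L2_on L2 Bochner_Integration.integral_sum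
        inner_vec_def matrix_vector_mult_def gram_def L2_inner_def sum_distrib_left mult_ac)
  have "(\<integral>y. (g y)\<^sup>2 \<partial>lebesgue_on Y) \<noteq> 0"
  proof
    assume "(\<integral>y. (g y)\<^sup>2 \<partial>lebesgue_on Y) = 0"
    then have "AE y in lebesgue_on Y. (g y)\<^sup>2 = 0"
      using integral_nonneg_eq_0_iff_AE[OF int] by simp
    then have "AE y in lebesgue_on Y. (\<Sum>i\<in>UNIV. c $ i * f i y) = 0"
      by (simp add: g_def)
    then have "\<forall>i. c $ i = 0"
      using ind unfolding L2_independent_def by (elim allE[of _ "($) c"]) blast
    with \<open>c \<noteq> 0\<close> show False
      by (simp add: vec_eq_iff)
  qed
  moreover have "0 \<le> (\<integral>y. (g y)\<^sup>2 \<partial>lebesgue_on Y)"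
    by simp
  ultimately show ?thesis
    unfolding eq by linarith
qed

section \<open>Two states\<close>

text \<open>With two states, a path between distinct states contains the direct transition.\<close>

lemma irreducible_chain_2_pos:
  fixes Q :: "real^2^2"
  assumes tm: "transition_matrix Q" and irr: "irreducible_chain Q" and "i \<noteq> j"
  shows "0 < Q $ i $ j"
proof (rule ccontr)
  assume "\<not> 0 < Q $ i $ j"
  then have Qij: "Q $ i $ j = 0"
    using tm unfolding transition_matrix_def by (meson order_antisym not_less)
  have UNIV: "UNIV = {i, j}"
    using \<open>i \<noteq> j\<close> exhaust_2[of i] exhaust_2[of j] by (auto simp: UNIV_2)
  have "matpow Q n $ i $ j = 0" for n
    using \<open>i \<noteq> j\<close> by (induction n) (simp_all add: mat_def matrix_matrix_mult_def UNIV Qij)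
  then show False
    using irr unfolding irreducible_chain_def by (metis less_irrefl)
qed

theorem lemma5:
  fixes Y :: "(real^'d) set"
    and Q :: "real^2^2"
    and \<pi> :: "real^2"
    and f :: "2 \<Rightarrow> real^'d \<Rightarrow> real"
  assumes "Y \<in> sets lebesgue"
    and "transition_matrix Q"
    and "rank Q = 2"
    and "irreducible_chain Q"
    and "aperiodic_chain Q"
    and "stationary_distribution Q \<pi>"
    and "\<And>i. f i \<in> L2_on Y"
    and "\<And>i. probability_density_on Y (f i)"
    and "L2_independent Y f"
  shows "H Q (gram Y f) > 0"
proof -
  have p: "0 < Q $ 1 $ 2" and q: "0 < Q $ 2 $ 1"
    using irreducible_chain_2_pos[OF assms(2,4)] by simp_all
  \<comment> \<open>The stationary distribution without its denominator; \<open>H\<close> is the determinant for these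
    weights.\<close>
  define \<nu> :: "real^2" where "\<nu> = vector [Q $ 2 $ 1, Q $ 1 $ 2]"
  have "invertible Q"
    using \<open>rank Q = 2\<close> by (simp add: invertible_det_nz det_eq_0_rank)
  moreover have "invertible (diag_matrix \<nu>)"
    using p q by (simp add: invertible_det_nz det_2 diag_matrix_def \<nu>_def)
  moreover obtain L :: "real^2^2" where "invertible L" and L: "gram Y f = L ** transpose L"
    by (rule cholesky_2[OF transpose_gram gram_posdef[OF assms(7,9)]])
  ultimately have pos: "0 < D_form \<nu> Q (gram Y f) U" if "U *v 1 = 0" "U \<noteq> 0" for U
    using that unfolding L by (intro D_form_pos)
  have "0 < c \<bullet> (D_matrix \<nu> Q (gram Y f) *v c)" if "c \<noteq> 0" for c
  proof -
    have "U_of c *v 1 = 0"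
      using range_U_of by blast
    moreover have "U_of c \<noteq> 0"
      using that by (auto simp: U_of_def vec_eq_iff)
    ultimately show ?thesis
      using pos by (simp add: D_form_eq_D_matrix[symmetric])
  qed
  then have "0 < det (D_matrix \<nu> Q (gram Y f))"
    by (rule posdef_2(2)[OF D_matrix_symmetric])
  then show ?thesis
    using H_eq_numerator[OF assms(2)] p q by (simp add: \<nu>_def)
qed

end
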